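(* Let $\mathscr{G}(X,Y)$ be the $2$-sort species of bicolored graphs. Then the cycle index of $\mathscr{G}(X,Y)$ is $$Z_{\mathscr{G}(X,Y)}=\sum_{m,n\ge 0}\biggl(\sum_{\lambda\vdash m,\ \mu\vdash n}2^{\sum_{i,j}\gcd(\lambda_i,\mu_j)}\,\frac{p_\lambda[\mathbf{x}]}{z_\lambda}\,\frac{p_\mu[\mathbf{y}]}{z_\mu}\biggr),$$ where $\lambda=(\lambda_1,\lambda_2,\dots)$ and $\mu=(\mu_1,\mu_2,\dots)$ are partitions and the sum $\sum_{i,j}$ runs over all pairs of parts of $\lambda$ and $\mu$.
   Context: A bicolored graph is a finite simple graph whose vertices are properly colored with white and black (adjacent vertices have different colors; the coloring is part of the structure). A $2$-sort species $F(X,Y)$ assigns functorially to each pair $(U_1,U_2)$ of finite sets a finite set $F[U_1,U_2]$ and to each pair of bijections $(\tau_1,\tau_2):(U_1,U_2)\to(V_1,V_2)$ a bijection $F[U_1,U_2]\to F[V_1,V_2]$. For $\mathscr{G}(X,Y)$, the structures on $(W,B)$ are the bicolored graphs whose set of white vertices is $W$ and whose set of black vertices is $B$, with transport by relabeling. The cycle index is $Z_{F(X,Y)}=\sum_{m,n\ge0}\sum_{\lambda\vdash m,\mu\vdash n}\mathrm{fix}\,F[\lambda,\mu]\,\frac{p_\lambda[\mathbf{x}]}{z_\lambda}\frac{p_\mu[\mathbf{y}]}{z_\mu}$, where $\mathrm{fix}\,F[\lambda,\mu]$ is the number of $F$-structures on $(\{1,\dots,m\},\{1,\dots,n\})$ fixed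 by transport along $(\sigma,\pi)$, with $\sigma,\pi$ any permutations of cycle types $\lambda,\mu$. Here $z_\lambda$ is the number of permutations in $\mathfrak{S}_m$ commuting with a given permutation of cycle type $\lambda\vdash m$, and $p_\lambda[\mathbf{x}]$, $p_\mu[\mathbf{y}]$ are power sum symmetric functions in two independent sets of variables $x_1,x_2,\dots$ and $y_1,y_2,\dots$. *)

theory Defs
  imports
    "HOL-Analysis.Infinite_Sum"
    "HOL-Combinatorics.Permutations"
    "HOL-Combinatorics.Orbits"
    "HOL-Library.Multiset"
begin

section \<open>Formal power series in arbitrarily many variables\<close>

text \<open>
  A monomial in the variables \<open>'v\<close> is a finite multiset of variables (the multiplicity is the
  exponent), so that the product of monomials is multiset sum. A formal power series assigns a
  coefficient to each monomial.
\<close>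

typedef ('v, 'a) mps = "UNIV :: ('v multiset \<Rightarrow> 'a) set"
  morphisms mps_coeff Abs_mps
  by simp

setup_lifting type_definition_mps

lemma mps_eq_iff: "f = g \<longleftrightarrow> (\<forall>M. mps_coeff f M = mps_coeff g M)"
  by (metis ext mps_coeff_inject)

lemma mps_eqI: "(\<And>M. mps_coeff f M = mps_coeff g M) \<Longrightarrow> f = g"
  by (simp add: mps_eq_iff)

lemma finite_submsets [simp]: "finite {A. A \<subseteq># (M :: 'v multiset)}"
proof (induction M)
  case (add x M)
  have "{A. A \<subseteq># add_mset x M} \<subseteq> {A. A \<subseteq># M} \<union> add_mset x ` {A. A \<subseteq># M}"
  proof
    fix A assume "A \<in> {A. A \<subseteq># add_mset x M}"
    then have A: "A \<subseteq># add_mset x M" by simp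
    show "A \<in> {A. A \<subseteq># M} \<union> add_mset x ` {A. A \<subseteq># M}"
    proof (cases "x \<in># A")
      case True
      then obtain B where "A = add_mset x B" by (meson mset_add)
      with A show ?thesis by auto
    next
      case False
      with A have "A \<subseteq># M"
        by (metis diff_single_trivial add_mset_remove_trivial subset_eq_diff_conv
            union_mset_add_mset_right add.right_neutral add_mset_add_single)
      then show ?thesis by simp
    qed
  qed
  then show ?case using add finite_subset by blast
qed auto

instantiation mps :: (type, ab_group_add) ab_group_add
begin
lift_definition zero_mps :: "('a, 'b) mps" is "\<lambda>_. 0" .
lift_definition plus_mps :: "('a, 'b) mps \<Rightarrow> ('a, 'b) mps \<Rightarrow> ('a, 'b) mps" is "\<lambda>f g M. f M + g M" .
lift_definition minus_mps :: "('a, 'b) mps \<Rightarrow> ('a, 'b) mps \<Rightarrow> ('a, 'b) mps" is "\<lambda>f g M. f M - g M" .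
lift_definition uminus_mps :: "('a, 'b) mps \<Rightarrow> ('a, 'b) mps" is "\<lambda>f M. - f M" .
instance by standard (transfer; simp add: fun_eq_iff algebra_simps)+
end

instantiation mps :: (type, comm_ring_1) comm_ring_1
begin
lift_definition one_mps :: "('a, 'b) mps" is "\<lambda>M. if M = {#} then 1 else 0" .
lift_definition times_mps :: "('a, 'b) mps \<Rightarrow> ('a, 'b) mps \<Rightarrow> ('a, 'b) mps"
  is "\<lambda>f g M. \<Sum>A | A \<subseteq># M. f A * g (M - A)" .
instance
proof
  fix a b c :: "('a, 'b) mps"
  show "a * b * c = a * (b * c)"
  proof (transfer, rule ext)
    fix a b c :: "'a multiset \<Rightarrow> 'b" and M
    have "(\<Sum>A | A \<subseteq># M. (\<Sum>B | B \<subseteq># A. a B * b (A - B)) * c (M - A))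
        = (\<Sum>(A, B)\<in>(SIGMA A:{A. A \<subseteq># M}. {B. B \<subseteq># A}). a B * b (A - B) * c (M - A))"
      by (subst sum.Sigma [symmetric]) (auto simp: sum_distrib_right)
    also have "\<dots> = (\<Sum>(B, C)\<in>(SIGMA B:{B. B \<subseteq># M}. {C. C \<subseteq># M - B}).
                      a B * (b C * c (M - B - C)))"
    proof (rule sum.reindex_bij_witness
        [where j = "\<lambda>(A, B). (B, A - B)" and i = "\<lambda>(B, C). (B + C, B)"], goal_cases)
      case (1 x) then show ?case by (auto simp: subset_mset.add_diff_inverse)
    next
      case (2 x) then show ?case
        by (auto intro: subset_mset.order_trans simp: subset_eq_diff_conv)
    next
      case (3 x) then show ?case by auto
    next
      case (4 x) then show ?case
        by (auto simp: subset_mset.le_diff_conv2 add.commute)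
    next
      case (5 x)
      have "M - B - (A - B) = M - A" if "B \<subseteq># A" for A B
        using that by (metis diff_diff_add_mset subset_mset.add_diff_inverse)
      with 5 show ?case by (auto simp: mult.assoc)
    qed
    also have "\<dots> = (\<Sum>B | B \<subseteq># M. a B * (\<Sum>C | C \<subseteq># M - B. b C * c (M - B - C)))"
      by (subst sum.Sigma [symmetric]) (auto simp: sum_distrib_left)
    finally show "(\<Sum>A | A \<subseteq># M. (\<Sum>B | B \<subseteq># A. a B * b (A - B)) * c (M - A))
        = (\<Sum>B | B \<subseteq># M. a B * (\<Sum>C | C \<subseteq># M - B. b C * c (M - B - C)))" .
  qed
  show "a * b = b * a"
  proof (transfer, rule ext)
    fix a b :: "'a multiset \<Rightarrow> 'b" and M
    show "(\<Sum>A | A \<subseteq># M. a A * b (M - A)) = (\<Sum>A | A \<subseteq># M. b A * a (M - A))"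
      by (rule sum.reindex_bij_witness [where j = "\<lambda>A. M - A" and i = "\<lambda>A. M - A"])
         (auto simp: mult.commute subset_mset.diff_diff_right)
  qed
  show "1 * a = a"
  proof (transfer, rule ext)
    fix a :: "'a multiset \<Rightarrow> 'b" and M
    have "(\<Sum>A | A \<subseteq># M. (if A = {#} then 1 else 0) * a (M - A))
        = (\<Sum>A\<in>{{#}}. (if A = {#} then 1 else 0) * a (M - A))"
      by (rule sum.mono_neutral_right) auto
    then show "(\<Sum>A | A \<subseteq># M. (if A = {#} then 1 else 0) * a (M - A)) = a M" by simp
  qed
  show "(a + b) * c = a * c + b * c"
    by transfer (simp add: algebra_simps sum.distrib)
  show "(0 :: ('a, 'b) mps) \<noteq> 1"
    by transfer (metis zero_neq_one)
qed
end

lift_definition mps_var :: "'v \<Rightarrow> ('v, 'a::comm_ring_1) mps"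
  is "\<lambda>v M. if M = {#v#} then 1 else 0" .

lift_definition mps_smult :: "'a::comm_ring_1 \<Rightarrow> ('v, 'a) mps \<Rightarrow> ('v, 'a) mps"
  is "\<lambda>c f M. c * f M" .

lemma mps_coeff_0 [simp]: "mps_coeff 0 M = 0" by transfer simp
lemma mps_coeff_1: "mps_coeff 1 M = (if M = {#} then 1 else 0)" by transfer simp
lemma mps_coeff_add [simp]: "mps_coeff (f + g) M = mps_coeff f M + mps_coeff g M"
  by transfer simp
lemma mps_coeff_mult: "mps_coeff (f * g) M = (\<Sum>A | A \<subseteq># M. mps_coeff f A * mps_coeff g (M - A))"
  by transfer simp
lemma mps_coeff_smult [simp]: "mps_coeff (mps_smult c f) M = c * mps_coeff f M"
  by transfer simp
lemma mps_coeff_sum: "mps_coeff (sum f S) M = (\<Sum>i\<in>S. mps_coeff (f i) M)"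
  by (induction S rule: infinite_finite_induct) auto

text \<open>
  The topology of formal power series: the product topology with discrete coefficients. Thus an
  infinite sum converges iff each coefficient receives only finitely many nonzero contributions.
\<close>

instantiation mps :: (type, type) t2_space
begin
definition open_mps :: "('a, 'b) mps set \<Rightarrow> bool" where
  "open_mps U \<longleftrightarrow> (\<forall>f\<in>U. \<exists>S. finite S \<and> (\<forall>g. (\<forall>M\<in>S. mps_coeff g M = mps_coeff f M) \<longrightarrow> g \<in> U))"
instance
proof
  show "open (UNIV :: ('a, 'b) mps set)"
    unfolding open_mps_def by auto
next
  fix U V :: "('a, 'b) mps set" assume UV: "open U" "open V"
  show "open (U \<inter> V)"
    unfolding open_mps_def
  proof
    fix f assume "f \<in> U \<inter> V"
    with UV obtain S T where "finite S" "\<forall>g. (\<forall>M\<in>S. mps_coeff g M = mps_coeff f M) \<longrightarrow> g \<in> U"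
      "finite T" "\<forall>g. (\<forall>M\<in>T. mps_coeff g M = mps_coeff f M) \<longrightarrow> g \<in> V"
      unfolding open_mps_def by (metis IntE)
    then show "\<exists>S. finite S \<and> (\<forall>g. (\<forall>M\<in>S. mps_coeff g M = mps_coeff f M) \<longrightarrow> g \<in> U \<inter> V)"
      by (intro exI [of _ "S \<union> T"]) auto
  qed
next
  fix K :: "('a, 'b) mps set set" assume "\<forall>U\<in>K. open U"
  then show "open (\<Union>K)"
    unfolding open_mps_def by (metis UnionE UnionI)
next
  fix f g :: "('a, 'b) mps" assume "f \<noteq> g"
  then obtain M where M: "mps_coeff f M \<noteq> mps_coeff g M" by (auto simp: mps_eq_iff)
  have "open {h. mps_coeff h M = c}" for c :: 'b
    unfolding open_mps_def by (intro ballI exI [of _ "{M}"]) auto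
  with M show "\<exists>U V. open U \<and> open V \<and> f \<in> U \<and> g \<in> V \<and> U \<inter> V = {}"
    by (intro exI [of _ "{h. mps_coeff h M = mps_coeff f M}"]
        exI [of _ "{h. mps_coeff h M = mps_coeff g M}"]) auto
qed
end

lemma mps_tendstoI:
  fixes g :: "'i \<Rightarrow> ('v, 'a) mps"
  assumes "\<And>M. eventually (\<lambda>i. mps_coeff (g i) M = mps_coeff l M) F"
  shows "(g \<longlongrightarrow> l) F"
proof (rule topological_tendstoI)
  fix U :: "('v, 'a) mps set" assume "open U" "l \<in> U"
  then obtain S where S: "finite S" "\<forall>g. (\<forall>M\<in>S. mps_coeff g M = mps_coeff l M) \<longrightarrow> g \<in> U"
    unfolding open_mps_def by blast
  have "eventually (\<lambda>i. \<forall>M\<in>S. mps_coeff (g i) M = mps_coeff l M) F"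
    using S(1) assms by (simp add: eventually_ball_finite)
  then show "eventually (\<lambda>i. g i \<in> U) F"
    by (rule eventually_mono) (use S(2) in blast)
qed

lemma mps_has_sumI:
  fixes f :: "'i \<Rightarrow> ('v, 'a::ab_group_add) mps"
  assumes fin: "\<And>M. finite {i\<in>I. mps_coeff (f i) M \<noteq> 0}"
    and sum: "\<And>M. mps_coeff s M = (\<Sum>i | i \<in> I \<and> mps_coeff (f i) M \<noteq> 0. mps_coeff (f i) M)"
  shows "(f has_sum s) I"
  unfolding has_sum_def
proof (rule mps_tendstoI)
  fix M
  let ?J = "{i\<in>I. mps_coeff (f i) M \<noteq> 0}"
  show "eventually (\<lambda>A. mps_coeff (sum f A) M = mps_coeff s M) (finite_subsets_at_top I)"
    unfolding eventually_finite_subsets_at_top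
  proof (intro exI [of _ ?J] conjI allI impI)
    fix A assume A: "finite A \<and> ?J \<subseteq> A \<and> A \<subseteq> I"
    have "mps_coeff (sum f A) M = (\<Sum>i\<in>A. mps_coeff (f i) M)"
      by (induction A rule: infinite_finite_induct) auto
    also have "\<dots> = (\<Sum>i\<in>?J. mps_coeff (f i) M)"
      by (rule sum.mono_neutral_right) (use A in auto)
    finally show "mps_coeff (sum f A) M = mps_coeff s M" by (simp add: sum)
  qed (use fin in auto)
qed

lemma mps_summableI:
  fixes f :: "'i \<Rightarrow> ('v, 'a::ab_group_add) mps"
  assumes "\<And>M. finite {i\<in>I. mps_coeff (f i) M \<noteq> 0}"
  shows "f summable_on I"
  unfolding summable_on_def
proof
  show "(f has_sum Abs_mps (\<lambda>M. \<Sum>i | i \<in> I \<and> mps_coeff (f i) M \<noteq> 0. mps_coeff (f i) M)) I"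
    by (rule mps_has_sumI [OF assms]) (auto simp: Abs_mps_inverse)
qed


section \<open>Partitions and power sum symmetric functions\<close>

text \<open>A partition is represented by the multiset of its parts.\<close>

definition partitions_of :: "nat \<Rightarrow> nat multiset set" where
  "partitions_of n = {lam. 0 \<notin># lam \<and> sum_mset lam = n}"

text \<open>The variables are the family \<open>x\<close>, indexed by the natural numbers.\<close>

definition power_sum :: "(nat \<Rightarrow> 'v) \<Rightarrow> nat \<Rightarrow> ('v, rat) mps" where
  "power_sum x k = (\<Sum>\<^sub>\<infinity>i. mps_var (x i) ^ k)"

definition power_sum_partition :: "(nat \<Rightarrow> 'v) \<Rightarrow> nat multiset \<Rightarrow> ('v, rat) mps" where
  "power_sum_partition x lam = (\<Prod>k\<in>#lam. power_sum x k)"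

text \<open>
  Two independent sets of variables: \<open>Inl i\<close> and \<open>Inr i\<close> stand for $x_{i+1}$ and $y_{i+1}$.
\<close>

abbreviation p_x :: "nat multiset \<Rightarrow> (nat + nat, rat) mps" where
  "p_x \<equiv> power_sum_partition Inl"

abbreviation p_y :: "nat multiset \<Rightarrow> (nat + nat, rat) mps" where
  "p_y \<equiv> power_sum_partition Inr"

lemma finite_partitions_of [simp]: "finite (partitions_of n)"
proof (rule finite_subset)
  show "partitions_of n \<subseteq> (\<Union>k\<le>n. mset ` {xs. set xs \<subseteq> {..n} \<and> length xs = k})"
  proof
    fix L assume L: "L \<in> partitions_of n"
    obtain xs where xs: "L = mset xs" by (metis ex_mset)
    have "length xs \<le> sum_list xs" if "0 \<notin> set xs" for xs :: "nat list"
      using that by (induction xs) auto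
    with L xs have "length xs \<le> n"
      by (auto simp: partitions_of_def sum_mset_sum_list)
    moreover have "set xs \<subseteq> {..n}"
      using L xs member_le_sum_list by (fastforce simp: partitions_of_def sum_mset_sum_list)
    ultimately show "L \<in> (\<Union>k\<le>n. mset ` {xs. set xs \<subseteq> {..n} \<and> length xs = k})"
      using xs by auto
  qed
qed (auto intro!: finite_imageI finite_lists_length_eq)

lemma mps_coeff_var_power:
  "mps_coeff (mps_var v ^ k :: ('v, 'a::comm_ring_1) mps) M = (if M = replicate_mset k v then 1 else 0)"
proof (induction k arbitrary: M)
  case (Suc k)
  have "mps_coeff (mps_var v ^ Suc k :: ('v, 'a) mps) M
      = (\<Sum>A | A \<subseteq># M. (if A = {#v#} then 1 else 0) * mps_coeff (mps_var v ^ k) (M - A))"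
    by (simp add: mps_coeff_mult mps_var.rep_eq)
  also have "\<dots> = (\<Sum>A | A \<subseteq># M. if A = {#v#} then mps_coeff (mps_var v ^ k) (M - A) else 0)"
    by (intro sum.cong) auto
  also have "\<dots> = (if v \<in># M then mps_coeff (mps_var v ^ k) (M - {#v#}) else 0)"
    by (subst sum.delta) auto
  also have "\<dots> = (if M = replicate_mset (Suc k) v then 1 else 0)"
    by (auto simp: Suc.IH dest!: multi_member_split)
  finally show ?case .
qed (auto simp: mps_coeff_1)

lemma power_sum_summable:
  assumes "inj x" "k > 0"
  shows "(\<lambda>i. mps_var (x i) ^ k :: ('v, rat) mps) summable_on UNIV"
proof (rule mps_summableI)
  fix M
  have "i = j" if "M = replicate_mset k (x i)" "M = replicate_mset k (x j)" for i j
    using that assms by (metis in_replicate_mset injD)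
  then have "{i. M = replicate_mset k (x i)} \<subseteq> {THE i. M = replicate_mset k (x i)}"
    by (auto intro!: the_equality [symmetric])
  then show "finite {i \<in> UNIV. mps_coeff (mps_var (x i) ^ k :: ('v, rat) mps) M \<noteq> 0}"
    by (auto simp: mps_coeff_var_power intro: finite_subset)
qed

lemma power_sum_coeff:
  assumes "inj x" "k > 0"
  shows "mps_coeff (power_sum x k) M = (if \<exists>i. M = replicate_mset k (x i) then 1 else 0)"
proof -
  define s :: "('a, rat) mps"
    where "s = Abs_mps (\<lambda>M. if \<exists>i. M = replicate_mset k (x i) then 1 else 0)"
  have uniq: "i = j" if "M = replicate_mset k (x i)" "M = replicate_mset k (x j)" for i j M
    using that assms by (metis in_replicate_mset injD)
  have "((\<lambda>i. mps_var (x i) ^ k) has_sum s) UNIV"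
  proof (rule mps_has_sumI)
    fix M
    have *: "{i \<in> UNIV. mps_coeff (mps_var (x i) ^ k :: ('a, rat) mps) M \<noteq> 0}
        = {i. M = replicate_mset k (x i)}"
      by (auto simp: mps_coeff_var_power)
    have **: "{i. M = replicate_mset k (x i)} = {}
        \<or> (\<exists>j. M = replicate_mset k (x j) \<and> {i. M = replicate_mset k (x i)} = {j})"
      using uniq by blast
    show "finite {i \<in> UNIV. mps_coeff (mps_var (x i) ^ k :: ('a, rat) mps) M \<noteq> 0}"
      unfolding * using ** by (metis finite.emptyI finite.insertI)
    show "mps_coeff s M = (\<Sum>i | i \<in> UNIV \<and> mps_coeff (mps_var (x i) ^ k :: ('a, rat) mps) M \<noteq> 0.
        mps_coeff (mps_var (x i) ^ k) M)"
      unfolding * using ** by (auto simp: s_def Abs_mps_inverse mps_coeff_var_power)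
  qed
  then have "power_sum x k = s"
    unfolding power_sum_def by (rule infsumI)
  then show ?thesis by (simp add: s_def Abs_mps_inverse)
qed

lemma power_sum_partition_homogeneous:
  assumes "inj x" "0 \<notin># lam" "mps_coeff (power_sum_partition x lam) M \<noteq> 0"
  shows "set_mset M \<subseteq> range x \<and> size M = sum_mset lam"
  using assms(2,3)
proof (induction lam arbitrary: M)
  case empty
  then show ?case
    by (auto simp: power_sum_partition_def mps_coeff_1 split: if_splits)
next
  case (add k lam)
  have "mps_coeff (power_sum x k * power_sum_partition x lam) M \<noteq> 0"
    using add.prems by (simp add: power_sum_partition_def)
  then obtain A where A: "A \<subseteq># M" "mps_coeff (power_sum x k) A \<noteq> 0"
      "mps_coeff (power_sum_partition x lam) (M - A) \<noteq> 0"
    unfolding mps_coeff_mult by (metis (no_types, lifting) mem_Collect_eq mult_eq_0_iff sum.neutral)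
  obtain i where i: "A = replicate_mset k (x i)"
    using A(2) power_sum_coeff [OF assms(1), of k] add.prems(1) by (auto split: if_splits)
  have "set_mset (M - A) \<subseteq> range x \<and> size (M - A) = sum_mset lam"
    using add.IH [OF _ A(3)] add.prems(1) by auto
  moreover have "set_mset M = set_mset A \<union> set_mset (M - A)" "size M = size A + size (M - A)"
    using A(1) by (metis set_mset_union subset_mset.add_diff_inverse)
      (metis A(1) size_union subset_mset.add_diff_inverse)
  ultimately show ?case using i by (auto split: if_splits)
qed


section \<open>Cycle types\<close>

text \<open>
  \<open>orbit \<sigma> x\<close> is the set of \<open>(\<sigma> ^^ k) x\<close> with \<open>k > 0\<close>, which for a permutation of a finite set is the
  cycle through \<open>x\<close>; fixed points contribute parts 1.
\<close>

definition cycle_type :: "'a set \<Rightarrow> ('a \<Rightarrow> 'a) \<Rightarrow> nat multiset" where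
  "cycle_type S \<sigma> = image_mset card (mset_set (orbit \<sigma> ` S))"

text \<open>
  An arbitrary permutation of the given cycle type. Permutations of equal cycle type are conjugate,
  so neither \<open>zee\<close> nor, for a species, \<open>fix_count\<close> depends on the choice.
\<close>

definition perm_of_type :: "nat multiset \<Rightarrow> nat \<Rightarrow> nat" where
  "perm_of_type lam = (SOME \<sigma>. \<sigma> permutes {1..sum_mset lam} \<and> cycle_type {1..sum_mset lam} \<sigma> = lam)"

definition zee :: "nat multiset \<Rightarrow> nat" where
  "zee lam = card {\<tau>. \<tau> permutes {1..sum_mset lam} \<and> \<tau> \<circ> perm_of_type lam = perm_of_type lam \<circ> \<tau>}"


section \<open>Two-sort species\<close>

text \<open>
  \<open>transport F U\<^sub>1 U\<^sub>2 \<tau>\<^sub>1 \<tau>\<^sub>2\<close> is the action of the pair of bijections \<open>(\<tau>\<^sub>1, \<tau>\<^sub>2)\<close> with domain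
  \<open>(U\<^sub>1, U\<^sub>2)\<close>; the domain is an argument since HOL functions are total, and the law
  \<open>transport_cong\<close> below says that values of \<open>\<tau>\<^sub>1, \<tau>\<^sub>2\<close> outside the domain are irrelevant.
\<close>

record ('a, 'b, 's) species2 =
  structs :: "'a set \<Rightarrow> 'b set \<Rightarrow> 's set"
  transport :: "'a set \<Rightarrow> 'b set \<Rightarrow> ('a \<Rightarrow> 'a) \<Rightarrow> ('b \<Rightarrow> 'b) \<Rightarrow> 's \<Rightarrow> 's"

locale two_sort_species =
  fixes F :: "('a, 'b, 's) species2"
  assumes finite_structs: "finite U1 \<Longrightarrow> finite U2 \<Longrightarrow> finite (structs F U1 U2)"
    and transport_bij:
      "finite U1 \<Longrightarrow> finite U2 \<Longrightarrow> bij_betw \<tau>1 U1 V1 \<Longrightarrow> bij_betw \<tau>2 U2 V2 \<Longrightarrow>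
        bij_betw (transport F U1 U2 \<tau>1 \<tau>2) (structs F U1 U2) (structs F V1 V2)"
    and transport_cong:
      "finite U1 \<Longrightarrow> finite U2 \<Longrightarrow> bij_betw \<tau>1 U1 V1 \<Longrightarrow> bij_betw \<tau>2 U2 V2 \<Longrightarrow>
        (\<And>u. u \<in> U1 \<Longrightarrow> \<rho>1 u = \<tau>1 u) \<Longrightarrow> (\<And>u. u \<in> U2 \<Longrightarrow> \<rho>2 u = \<tau>2 u) \<Longrightarrow>
        s \<in> structs F U1 U2 \<Longrightarrow> transport F U1 U2 \<rho>1 \<rho>2 s = transport F U1 U2 \<tau>1 \<tau>2 s"
    and transport_id:
      "finite U1 \<Longrightarrow> finite U2 \<Longrightarrow> s \<in> structs F U1 U2 \<Longrightarrow> transport F U1 U2 id id s = s"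
    and transport_comp:
      "finite U1 \<Longrightarrow> finite U2 \<Longrightarrow> bij_betw \<tau>1 U1 V1 \<Longrightarrow> bij_betw \<tau>2 U2 V2 \<Longrightarrow>
        bij_betw \<rho>1 V1 W1 \<Longrightarrow> bij_betw \<rho>2 V2 W2 \<Longrightarrow> s \<in> structs F U1 U2 \<Longrightarrow>
        transport F U1 U2 (\<rho>1 \<circ> \<tau>1) (\<rho>2 \<circ> \<tau>2) s
          = transport F V1 V2 \<rho>1 \<rho>2 (transport F U1 U2 \<tau>1 \<tau>2 s)"

definition fix_count :: "(nat, nat, 's) species2 \<Rightarrow> nat multiset \<Rightarrow> nat multiset \<Rightarrow> nat" where
  "fix_count F lam mu = card {s \<in> structs F {1..sum_mset lam} {1..sum_mset mu}.
     transport F {1..sum_mset lam} {1..sum_mset mu} (perm_of_type lam) (perm_of_type mu) s = s}"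

definition cycle_index :: "(nat, nat, 's) species2 \<Rightarrow> (nat + nat, rat) mps" where
  "cycle_index F = (\<Sum>\<^sub>\<infinity>(m, n). \<Sum>lam\<in>partitions_of m. \<Sum>mu\<in>partitions_of n.
     mps_smult (of_nat (fix_count F lam mu))
       (mps_smult (1 / of_nat (zee lam)) (p_x lam) * mps_smult (1 / of_nat (zee mu)) (p_y mu)))"

text \<open>Series of the shape of a cycle index are always summable, whatever the coefficients.\<close>

lemma cycle_index_summable:
  fixes c :: "nat multiset \<Rightarrow> nat multiset \<Rightarrow> rat"
  shows "(\<lambda>(m, n). \<Sum>lam\<in>partitions_of m. \<Sum>mu\<in>partitions_of n.
      mps_smult (c lam mu) (mps_smult (a lam) (p_x lam) * mps_smult (b mu) (p_y mu))) summable_on UNIV"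
    (is "?f summable_on UNIV")
proof (rule mps_summableI)
  fix M :: "(nat + nat) multiset"
  have "i \<in> {..size M} \<times> {..size M}" if nz: "mps_coeff (?f i) M \<noteq> 0" for i
  proof -
    obtain m n where i: "i = (m, n)" by (cases i)
    from nz obtain L U where LU: "L \<in> partitions_of m" "U \<in> partitions_of n"
      "mps_coeff (mps_smult (a L) (p_x L) * mps_smult (b U) (p_y U)) M \<noteq> 0"
      unfolding i by (auto simp: mps_coeff_sum elim!: sum.not_neutral_contains_not_neutral)
    then obtain A where A: "A \<subseteq># M" "mps_coeff (p_x L) A \<noteq> 0" "mps_coeff (p_y U) (M - A) \<noteq> 0"
      by (auto simp: mps_coeff_mult elim!: sum.not_neutral_contains_not_neutral)
    have "size A = m" "size (M - A) = n"
      using A LU power_sum_partition_homogeneous [of Inl L A]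
        power_sum_partition_homogeneous [of Inr U "M - A"] by (auto simp: partitions_of_def)
    then show ?thesis
      using A(1) i by (auto simp: size_mset_mono diff_subset_eq_self)
  qed
  then have "{i \<in> UNIV. mps_coeff (?f i) M \<noteq> 0} \<subseteq> {..size M} \<times> {..size M}" by blast
  then show "finite {i \<in> UNIV. mps_coeff (?f i) M \<noteq> 0}"
    using finite_subset by blast
qed


section \<open>Bicolored graphs\<close>

record 'v bigraph =
  whites :: "'v set"
  blacks :: "'v set"
  edges :: "'v set set"

definition bicolored_graph :: "'v bigraph \<Rightarrow> bool" where
  "bicolored_graph G \<longleftrightarrow>
     finite (whites G \<union> blacks G) \<and> whites G \<inter> blacks G = {} \<and>
     (\<forall>e\<in>edges G. e \<subseteq> whites G \<union> blacks G \<and> card e = 2) \<and>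
     (\<forall>u v. {u, v} \<in> edges G \<longrightarrow> (u \<in> whites G \<longleftrightarrow> v \<in> blacks G))"

definition relabel :: "('v \<Rightarrow> 'w) \<Rightarrow> 'v bigraph \<Rightarrow> 'w bigraph" where
  "relabel f G = \<lparr>whites = f ` whites G, blacks = f ` blacks G, edges = (`) f ` edges G\<rparr>"

text \<open>
  The two label sets of a 2-sort species need not be disjoint (as with \<open>{1..m}\<close> and \<open>{1..n}\<close>), so
  white vertices carry the tag \<^const>\<open>Inl\<close> and black ones the tag \<^const>\<open>Inr\<close>.
\<close>

definition bicolored_graphs :: "('a, 'b, ('a + 'b) bigraph) species2" where
  "bicolored_graphs = \<lparr>
     structs = (\<lambda>W B. {G. bicolored_graph G \<and> whites G = Inl ` W \<and> blacks G = Inr ` B}),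
     transport = (\<lambda>W B \<tau>1 \<tau>2. relabel (map_sum \<tau>1 \<tau>2))\<rparr>"

lemma relabel_comp: "relabel (g \<circ> f) G = relabel g (relabel f G)"
  by (simp add: relabel_def image_comp image_image)

lemma relabel_cong:
  assumes "bicolored_graph G" "\<And>v. v \<in> whites G \<union> blacks G \<Longrightarrow> f v = g v"
  shows "relabel f G = relabel g G"
proof -
  have "f ` e = g ` e" if "e \<in> edges G" for e
    using that assms unfolding bicolored_graph_def by (intro image_cong) auto
  then show ?thesis
    unfolding relabel_def using assms(2) by (auto intro!: image_cong)
qed

lemma relabel_ident:
  assumes "bicolored_graph G" "\<And>v. v \<in> whites G \<union> blacks G \<Longrightarrow> f v = v"
  shows "relabel f G = G"
  using relabel_cong [of G f id] assms by (simp add: relabel_def)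

lemma bicolored_graph_relabel:
  assumes G: "bicolored_graph G" and inj: "inj_on f (whites G \<union> blacks G)"
  shows "bicolored_graph (relabel f G)"
proof -
  let ?V = "whites G \<union> blacks G"
  have V: "finite ?V" "whites G \<inter> blacks G = {}"
    and E: "\<And>e. e \<in> edges G \<Longrightarrow> e \<subseteq> ?V \<and> card e = 2"
    and P: "\<And>u v. {u, v} \<in> edges G \<Longrightarrow> u \<in> whites G \<longleftrightarrow> v \<in> blacks G"
    using G by (auto simp: bicolored_graph_def)
  have col: "f u \<in> f ` whites G \<longleftrightarrow> u \<in> whites G" "f u \<in> f ` blacks G \<longleftrightarrow> u \<in> blacks G"
    if "u \<in> ?V" for u
    using that inj by (auto dest: inj_onD)
  have "u \<in> f ` whites G \<longleftrightarrow> v \<in> f ` blacks G" if "e \<in> edges G" "{u, v} = f ` e" for u v e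
  proof -
    have "card e = 2" using E that(1) by blast
    then obtain a b where ab: "e = {a, b}" by (auto simp: card_2_iff)
    then have *: "a \<in> ?V" "b \<in> ?V" using E [of e] that(1) by auto
    have "u = f a \<and> v = f b \<or> u = f b \<and> v = f a"
      using that(2) ab by (auto simp: doubleton_eq_iff)
    then show ?thesis
      using P [of a b] P [of b a] that(1) ab * col by (auto simp: insert_commute)
  qed
  moreover have "f ` whites G \<inter> f ` blacks G = {}"
    using V(2) inj by (auto dest: inj_onD)
  moreover have "card (f ` e) = 2" if "e \<in> edges G" for e
    using E [OF that] inj by (metis card_image inj_on_subset)
  moreover have "f ` e \<subseteq> f ` whites G \<union> f ` blacks G" if "e \<in> edges G" for e
    using E [OF that] by blast
  moreover have "finite (f ` whites G \<union> f ` blacks G)"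
    using V(1) by simp
  ultimately show ?thesis
    unfolding bicolored_graph_def relabel_def bigraph.simps ball_simps(9) by (meson imageE)
qed

lemma map_sum_bij_betw_inv:
  assumes "bij_betw f A A'" "bij_betw g B B'" "v \<in> Inl ` A \<union> Inr ` B"
  shows "map_sum (inv_into A f) (inv_into B g) (map_sum f g v) = v"
  using assms by (auto simp: bij_betw_def)

lemma structs_relabel:
  assumes "bij_betw \<tau>1 U1 V1" "bij_betw \<tau>2 U2 V2" "G \<in> structs bicolored_graphs U1 U2"
  shows "relabel (map_sum \<tau>1 \<tau>2) G \<in> structs bicolored_graphs V1 V2"
proof -
  have "inj_on (map_sum \<tau>1 \<tau>2) (Inl ` U1 \<union> Inr ` U2)"
    using map_sum_bij_betw_inv [OF assms(1,2)] by (rule inj_on_inverseI)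
  then have "bicolored_graph (relabel (map_sum \<tau>1 \<tau>2) G)"
    using assms(3) by (intro bicolored_graph_relabel) (auto simp: bicolored_graphs_def)
  moreover have "map_sum \<tau>1 \<tau>2 ` Inl ` U1 = Inl ` V1" "map_sum \<tau>1 \<tau>2 ` Inr ` U2 = Inr ` V2"
    using assms(1,2) by (auto simp: bij_betw_def image_image)
  ultimately show ?thesis
    using assms(3) by (simp add: bicolored_graphs_def relabel_def)
qed

lemma two_sort_species_bicolored_graphs:
  "two_sort_species (bicolored_graphs :: ('a, 'b, ('a + 'b) bigraph) species2)"
proof
  fix U1 V1 W1 :: "'a set" and U2 V2 W2 :: "'b set" and \<tau>1 \<rho>1 :: "'a \<Rightarrow> 'a" and \<tau>2 \<rho>2 :: "'b \<Rightarrow> 'b"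
    and s :: "('a + 'b) bigraph"
  assume fin: "finite U1" "finite U2"
  show "finite (structs bicolored_graphs U1 U2)"
  proof (rule finite_subset)
    show "structs bicolored_graphs U1 U2 \<subseteq>
      (\<lambda>E. \<lparr>whites = Inl ` U1, blacks = Inr ` U2, edges = E\<rparr>) ` Pow (Pow (Inl ` U1 \<union> Inr ` U2))"
    proof
      fix G :: "('a + 'b) bigraph" assume "G \<in> structs bicolored_graphs U1 U2"
      then have G: "bicolored_graph G" and W: "whites G = Inl ` U1" and B: "blacks G = Inr ` U2"
        by (simp_all add: bicolored_graphs_def)
      from G have "\<forall>e\<in>edges G. e \<subseteq> whites G \<union> blacks G"
        unfolding bicolored_graph_def by blast
      then have "\<forall>e\<in>edges G. e \<subseteq> Inl ` U1 \<union> Inr ` U2"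
        by (simp only: W B)
      with W B show "G \<in> (\<lambda>E. \<lparr>whites = Inl ` U1, blacks = Inr ` U2, edges = E\<rparr>)
          ` Pow (Pow (Inl ` U1 \<union> Inr ` U2))"
        by (intro image_eqI [of _ _ "edges G"]) (simp, blast)
    qed
  qed (use fin in auto)
  {
    assume s: "s \<in> structs bicolored_graphs U1 U2"
    show "transport bicolored_graphs U1 U2 id id s = s"
      using s by (auto simp: bicolored_graphs_def intro!: relabel_ident)
  }
  assume \<tau>: "bij_betw \<tau>1 U1 V1" "bij_betw \<tau>2 U2 V2"
  let ?f = "relabel (map_sum \<tau>1 \<tau>2)"
    and ?g = "relabel (map_sum (inv_into U1 \<tau>1) (inv_into U2 \<tau>2))"
  have inv: "bij_betw (inv_into U1 \<tau>1) V1 U1" "bij_betw (inv_into U2 \<tau>2) V2 U2"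
    using \<tau> bij_betw_inv_into by auto
  have "bij_betw ?f (structs bicolored_graphs U1 U2) (structs bicolored_graphs V1 V2)"
  proof (rule bij_betw_byWitness [where f' = ?g])
    show "\<forall>G\<in>structs bicolored_graphs U1 U2. ?g (?f G) = G"
    proof
      fix G assume G: "G \<in> structs bicolored_graphs U1 U2"
      show "?g (?f G) = G"
        unfolding relabel_comp [symmetric]
        by (rule relabel_ident)
           (use G map_sum_bij_betw_inv [OF \<tau>] in \<open>auto simp: bicolored_graphs_def\<close>)
    qed
    show "\<forall>G\<in>structs bicolored_graphs V1 V2. ?f (?g G) = G"
    proof
      fix G assume G: "G \<in> structs bicolored_graphs V1 V2"
      show "?f (?g G) = G"
        unfolding relabel_comp [symmetric]
        by (rule relabel_ident)
           (use G \<tau> in \<open>auto simp: bicolored_graphs_def bij_betw_inv_into_right\<close>)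
    qed
  qed (use structs_relabel [OF \<tau>] structs_relabel [OF inv] in auto)
  then show "bij_betw (transport bicolored_graphs U1 U2 \<tau>1 \<tau>2)
      (structs bicolored_graphs U1 U2) (structs bicolored_graphs V1 V2)"
    by (simp add: bicolored_graphs_def)
  {
    assume "\<And>u. u \<in> U1 \<Longrightarrow> \<rho>1 u = \<tau>1 u" "\<And>u. u \<in> U2 \<Longrightarrow> \<rho>2 u = \<tau>2 u"
      "s \<in> structs bicolored_graphs U1 U2"
    then show "transport bicolored_graphs U1 U2 \<rho>1 \<rho>2 s = transport bicolored_graphs U1 U2 \<tau>1 \<tau>2 s"
      by (auto simp: bicolored_graphs_def intro!: relabel_cong)
  }
  show "transport bicolored_graphs U1 U2 (\<rho>1 \<circ> \<tau>1) (\<rho>2 \<circ> \<tau>2) s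
      = transport bicolored_graphs V1 V2 \<rho>1 \<rho>2 (transport bicolored_graphs U1 U2 \<tau>1 \<tau>2 s)"
    by (simp add: bicolored_graphs_def map_sum.comp flip: relabel_comp)
qed

end

theory Submission
  imports Defs
begin

text \<open>
  The two series agree term by term, so everything comes down to
  \<open>fix_count bicolored_graphs \<lambda> \<mu> = 2 ^ (\<Sum>i\<in>#\<lambda>. \<Sum>j\<in>#\<mu>. gcd i j)\<close>. Let \<open>\<sigma>\<close> and \<open>\<pi>\<close> be the
  permutations of types \<open>\<lambda>\<close> and \<open>\<mu>\<close>. A bicolored graph on given white and black vertices \<open>W\<close>, \<open>B\<close>
  is nothing but a relation \<open>R \<subseteq> W \<times> B\<close> (\<open>structs_eq_graph_of_rel\<close>), and relabelling acts on it
  through the product map \<open>map_prod \<sigma> \<pi>\<close>. A relation is fixed precisely if it is a union of orbits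
  of this map, so the number of fixed graphs is two to the number of orbits on \<open>W \<times> B\<close>
  (\<open>card_invariant_subsets\<close>).

  The pair \<open>(w, b)\<close> returns to itself after \<open>n\<close> steps iff \<open>n\<close> is a multiple of both cycle lengths, so
  if \<open>w\<close> and \<open>b\<close> lie in cycles of lengths \<open>i\<close> and \<open>j\<close>, its orbit has length \<open>lcm i j\<close>. The product of
  these two cycles, with its \<open>i * j = gcd i j * lcm i j\<close> elements, therefore splits into \<open>gcd i j\<close>
  orbits (\<open>card_orbits_of_cyclic_Times\<close>), and summing over all pairs of cycles gives the exponent
  (\<open>card_orbits_Times\<close>).

  As \<open>perm_of_type\<close> is a choice, one also needs that permutations of every cycle type exist;
  they are obtained by gluing cyclic permutations of disjoint blocks
  (\<open>exists_permutation_of_cycle_type\<close>).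
\<close>

section \<open>Orbit lengths and numbers of orbits\<close>

lemma permutes_self_in_orbit: "finite S \<Longrightarrow> f permutes S \<Longrightarrow> x \<in> orbit f x"
  by (intro permutation_self_in_orbit permutes_imp_permutation)

lemma card_orbit_dvd_iff:
  assumes "x \<in> orbit f x"
  shows "card (orbit f x) dvd n \<longleftrightarrow> (f ^^ n) x = x"
proof -
  let ?k = "funpow_dist1 f x x"
  have k: "(f ^^ ?k) x = x"
    using assms by (rule funpow_dist1_prop)
  have "card (orbit f x) = ?k"
    using orbit_conv_funpow_dist1 [OF assms] inj_on_funpow_dist1 [OF assms]
    by (simp add: card_image)
  moreover have "(f ^^ n) x = (f ^^ (n mod ?k)) x"
    using funpow_mod_eq [OF k] by simp
  moreover have "n mod ?k < ?k"
    by (rule mod_less_divisor) simp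
  then have "(f ^^ (n mod ?k)) x \<noteq> x" if "0 < n mod ?k"
    using that by (intro funpow_dist1_least)
  ultimately show ?thesis
    by (metis dvd_eq_mod_eq_0 funpow_0 gr0I)
qed

lemma funpow_map_prod:
  fixes f :: "'a \<Rightarrow> 'a" and g :: "'b \<Rightarrow> 'b"
  shows "(map_prod f g ^^ n) (x, y) = ((f ^^ n) x, (g ^^ n) y)"
  by (induction n) auto

lemma orbit_map_prod:
  assumes "x \<in> orbit f x" "y \<in> orbit g y"
  shows self_in_orbit_map_prod: "(x, y) \<in> orbit (map_prod f g) (x, y)"
    and card_orbit_map_prod:
      "card (orbit (map_prod f g) (x, y)) = lcm (card (orbit f x)) (card (orbit g y))"
proof -
  let ?h = "map_prod f g"
  let ?l = "lcm (card (orbit f x)) (card (orbit g y))"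
  have return: "(?h ^^ n) (x, y) = (x, y) \<longleftrightarrow> ?l dvd n" for n
    using assms by (simp add: funpow_map_prod flip: card_orbit_dvd_iff)
  have "0 < ?l"
    using assms by (simp add: lcm_pos_nat card_gt_0_iff finite_orbit orbit_nonempty)
  then show self: "(x, y) \<in> orbit ?h (x, y)"
    using return [of ?l] unfolding orbit_altdef by (smt (verit) dvd_refl mem_Collect_eq)
  show "card (orbit ?h (x, y)) = ?l"
    using card_orbit_dvd_iff [OF self] return by (metis dvd_antisym dvd_refl)
qed

lemma orbit_eq_if_self_in:
  assumes "x \<in> orbit f x" "y \<in> orbit f x"
  shows "orbit f y = orbit f x"
  using assms by (meson orbit_swap orbit_trans subsetI subset_antisym)

text \<open>Orbits of cyclic points are equal or disjoint, so orbits of common size \<open>l\<close> tile \<open>X\<close>.\<close>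

lemma card_eq_card_orbits_times:
  assumes "finite X"
    and self: "\<And>x. x \<in> X \<Longrightarrow> x \<in> orbit f x"
    and sub: "\<And>x. x \<in> X \<Longrightarrow> orbit f x \<subseteq> X"
    and card: "\<And>x. x \<in> X \<Longrightarrow> card (orbit f x) = l"
  shows "card X = l * card (orbit f ` X)"
proof -
  have X: "\<Union> (orbit f ` X) = X"
    using self sub by blast
  have "l * card (orbit f ` X) = card (\<Union> (orbit f ` X))"
  proof (rule card_partition)
    fix P Q assume "P \<in> orbit f ` X" "Q \<in> orbit f ` X" "P \<noteq> Q"
    then show "P \<inter> Q = {}"
      using self orbit_eq_if_self_in by (metis (no_types, lifting) disjoint_iff imageE)
  qed (use assms X in auto)
  with X show ?thesis by simp
qed

lemma card_orbits_of_cyclic_Times: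
  assumes "cyclic_on f A" "cyclic_on g B"
  shows "card (orbit (map_prod f g) ` (A \<times> B)) = gcd (card A) (card B)"
proof -
  have A: "orbit f x = A" "x \<in> orbit f x" if "x \<in> A" for x
    using assms(1) that by (auto simp: cyclic_on_alldef)
  have B: "orbit g y = B" "y \<in> orbit g y" if "y \<in> B" for y
    using assms(2) that by (auto simp: cyclic_on_alldef)
  have fin: "finite A" "finite B" and ne: "A \<noteq> {}" "B \<noteq> {}"
    using assms by (auto simp: finite_cyclic_on cyclic_on_def)
  let ?l = "lcm (card A) (card B)"
  have "card (A \<times> B) = ?l * card (orbit (map_prod f g) ` (A \<times> B))"
  proof (rule card_eq_card_orbits_times)
    fix z assume "z \<in> A \<times> B"
    then obtain x y where z: "z = (x, y)" "x \<in> A" "y \<in> B" by auto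
    show "z \<in> orbit (map_prod f g) z" "card (orbit (map_prod f g) z) = ?l"
      using z A B by (simp_all add: self_in_orbit_map_prod card_orbit_map_prod)
    show "orbit (map_prod f g) z \<subseteq> A \<times> B"
      using z cyclic_on_funpow_in [OF assms(1)] cyclic_on_funpow_in [OF assms(2)]
      by (auto simp: orbit_altdef funpow_map_prod)
  qed (use fin in simp)
  then have "?l * gcd (card A) (card B) = ?l * card (orbit (map_prod f g) ` (A \<times> B))"
    by (metis card_cartesian_product prod_gcd_lcm_nat mult.commute)
  moreover have "?l \<noteq> 0"
    using fin ne by simp
  ultimately show ?thesis
    using nat_mult_eq_cancel1 by (metis gr0I)
qed

text \<open>
  Orbits of the product map through different pairs of cycles are different because an orbit
  projects onto the cycles of its members.
\<close>

lemma card_orbits_Times: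
  fixes S :: "'a set" and T :: "'b set"
  assumes "finite S" "f permutes S" "finite T" "g permutes T"
  shows "card (orbit (map_prod f g) ` (S \<times> T))
    = (\<Sum>i\<in>#cycle_type S f. \<Sum>j\<in>#cycle_type T g. gcd i j)"
proof -
  let ?h = "map_prod f g"
  let ?C = "orbit f ` S" and ?D = "orbit g ` T"
  have self: "x \<in> orbit f x" "y \<in> orbit g y" for x y
    using assms by (simp_all add: permutes_self_in_orbit)
  have cyc: "A \<in> ?C \<Longrightarrow> cyclic_on f A" "B \<in> ?D \<Longrightarrow> cyclic_on g B" for A B
    using cyclic_on_orbit [OF assms(2,1)] cyclic_on_orbit [OF assms(4,3)] by auto
  have "\<Union> ?C = S"
    using self(1) permutes_orbit_subset [OF assms(2)] by blast
  moreover have "\<Union> ?D = T"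
    using self(2) permutes_orbit_subset [OF assms(4)] by blast
  moreover have "\<Union> P \<times> \<Union> Q = (\<Union>p\<in>P \<times> Q. fst p \<times> snd p)"
    for P :: "'a set set" and Q :: "'b set set"
    by auto
  ultimately have "S \<times> T = (\<Union>p\<in>?C \<times> ?D. fst p \<times> snd p)"
    by metis
  then have "orbit ?h ` (S \<times> T) = (\<Union>(A, B)\<in>?C \<times> ?D. orbit ?h ` (A \<times> B))"
    by (simp only: image_UN case_prod_unfold)
  also have "card \<dots> = (\<Sum>(A, B)\<in>?C \<times> ?D. card (orbit ?h ` (A \<times> B)))"
    unfolding case_prod_unfold
  proof (rule card_UN_disjoint)
    show "\<forall>p\<in>?C \<times> ?D. finite (orbit ?h ` (fst p \<times> snd p))"
      using self by (auto intro!: finite_imageI finite_cartesian_product finite_orbit)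
    have proj: "fst ` orbit ?h z = A \<and> snd ` orbit ?h z = B"
      if "z \<in> A \<times> B" "A \<in> ?C" "B \<in> ?D" for z A B
    proof -
      have "fst ` orbit ?h z = orbit f (fst z)" "snd ` orbit ?h z = orbit g (snd z)"
        using self self_in_orbit_map_prod [of "fst z" f "snd z" g]
        by (intro orbit_inverse; simp)+
      with that cyc(1) [OF that(2)] cyc(2) [OF that(3)] show ?thesis
        by (metis mem_Times_iff orbit_cyclic_eq3)
    qed
    show "\<forall>p\<in>?C \<times> ?D. \<forall>q\<in>?C \<times> ?D. p \<noteq> q \<longrightarrow>
        orbit ?h ` (fst p \<times> snd p) \<inter> orbit ?h ` (fst q \<times> snd q) = {}"
    proof (intro ballI impI, rule ccontr)
      fix p q assume pq: "p \<in> ?C \<times> ?D" "q \<in> ?C \<times> ?D" "p \<noteq> q"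
        "orbit ?h ` (fst p \<times> snd p) \<inter> orbit ?h ` (fst q \<times> snd q) \<noteq> {}"
      then obtain z z' where z: "z \<in> fst p \<times> snd p" "z' \<in> fst q \<times> snd q" "orbit ?h z = orbit ?h z'"
        by blast
      with pq(1,2) proj [of z "fst p" "snd p"] proj [of z' "fst q" "snd q"] have "p = q"
        by (metis mem_Times_iff prod_eqI)
      with pq(3) show False ..
    qed
  qed (use assms in auto)
  also have "\<dots> = (\<Sum>(A, B)\<in>?C \<times> ?D. gcd (card A) (card B))"
    by (intro sum.cong) (auto intro!: card_orbits_of_cyclic_Times cyc)
  also have "\<dots> = (\<Sum>A\<in>?C. \<Sum>B\<in>?D. gcd (card A) (card B))"
    by (simp add: sum.cartesian_product)
  finally show ?thesis
    by (simp add: cycle_type_def sum_unfold_sum_mset image_mset.compositionality o_def)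
qed

text \<open>An invariant set is determined by, and can be any union of, the orbits contained in it.\<close>

lemma card_invariant_subsets:
  assumes "finite X"
    and self: "\<And>x. x \<in> X \<Longrightarrow> x \<in> orbit f x"
    and sub: "\<And>x. x \<in> X \<Longrightarrow> orbit f x \<subseteq> X"
  shows "card {R. R \<subseteq> X \<and> f ` R = R} = 2 ^ card (orbit f ` X)"
proof -
  have orbit_union: "\<Union> (orbit f ` R) = R" if "R \<subseteq> X" "f ` R = R" for R
  proof -
    have "orbit f x \<subseteq> R" if "x \<in> R" for x
    proof
      fix y assume "y \<in> orbit f x"
      then show "y \<in> R"
        by induction (use \<open>x \<in> R\<close> \<open>f ` R = R\<close> in blast)+
    qed
    with self that(1) show ?thesis by blast
  qed
  have "bij_betw (\<lambda>R. orbit f ` R) {R. R \<subseteq> X \<and> f ` R = R} (Pow (orbit f ` X))"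
  proof (rule bij_betw_byWitness [where f' = Union])
    show "\<forall>R\<in>{R. R \<subseteq> X \<and> f ` R = R}. \<Union> (orbit f ` R) = R"
      using orbit_union by blast
    show "\<forall>Q\<in>Pow (orbit f ` X). orbit f ` \<Union> Q = Q"
    proof
      fix Q assume Q: "Q \<in> Pow (orbit f ` X)"
      have "orbit f ` P = {P}" if P: "P \<in> Q" for P
      proof -
        obtain x where x: "x \<in> X" "P = orbit f x"
          using Q P by blast
        have "orbit f y = P" if "y \<in> P" for y
          using orbit_eq_if_self_in [OF self [OF x(1)], of y] that x(2) by simp
        moreover have "x \<in> P"
          using self [OF x(1)] x(2) by simp
        ultimately show ?thesis by blast
      qed
      then show "orbit f ` \<Union> Q = Q"
        by (simp add: image_Union)
    qed
    have "f ` orbit f x = orbit f x" if "x \<in> X" for x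
      using orbit_inverse [OF self [OF that], of f f] self_in_orbit_step [OF self [OF that]] by simp
    then have "f ` P = P" if "P \<in> orbit f ` X" for P
      using that by blast
    then have "(\<Union>P\<in>Q. f ` P) = (\<Union>P\<in>Q. P)" if "Q \<subseteq> orbit f ` X" for Q
      using that by (meson SUP_cong subsetD)
    then have "f ` \<Union> Q = \<Union> Q" if "Q \<subseteq> orbit f ` X" for Q
      using that by (simp add: image_Union)
    moreover have "\<Union> Q \<subseteq> X" if "Q \<subseteq> orbit f ` X" for Q
      using that sub by blast
    ultimately show "Union ` Pow (orbit f ` X) \<subseteq> {R. R \<subseteq> X \<and> f ` R = R}"
      by blast
  qed auto
  then show ?thesis
    using \<open>finite X\<close> by (simp add: bij_betw_same_card card_Pow)
qed

section \<open>Bicolored graphs as relations\<close>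

definition graph_of_rel :: "'a set \<Rightarrow> 'b set \<Rightarrow> ('a \<times> 'b) set \<Rightarrow> ('a + 'b) bigraph" where
  "graph_of_rel W B R =
    \<lparr>whites = Inl ` W, blacks = Inr ` B, edges = (\<lambda>(w, b). {Inl w, Inr b}) ` R\<rparr>"

lemma inj_edge: "inj (\<lambda>(w, b). {Inl w, Inr b})"
  by (auto simp: inj_on_def doubleton_eq_iff)

lemma inj_graph_of_rel: "inj (graph_of_rel W B)"
  by (rule injI) (simp add: graph_of_rel_def inj_image_eq_iff [OF inj_edge])

text \<open>Every edge joins a white to a black vertex, so a graph is the set of pairs it joins.\<close>

lemma structs_eq_graph_of_rel:
  assumes "finite W" "finite B"
  shows "structs bicolored_graphs W B = graph_of_rel W B ` Pow (W \<times> B)"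
proof (intro subset_antisym subsetI)
  fix G assume "G \<in> structs bicolored_graphs W B"
  then have G: "bicolored_graph G" and wb: "whites G = Inl ` W" "blacks G = Inr ` B"
    by (simp_all add: bicolored_graphs_def)
  let ?R = "{(w, b) \<in> W \<times> B. {Inl w, Inr b} \<in> edges G}"
  have "edges G = (\<lambda>(w, b). {Inl w, Inr b}) ` ?R"
  proof (intro subset_antisym subsetI)
    fix e assume e: "e \<in> edges G"
    then obtain u v where uv: "e = {u, v}"
      by (metis G bicolored_graph_def card_2_iff)
    have "e \<subseteq> Inl ` W \<union> Inr ` B"
      using G e wb by (auto simp: bicolored_graph_def)
    moreover have "u \<in> Inl ` W \<longleftrightarrow> v \<in> Inr ` B"
      using G e uv wb by (simp add: bicolored_graph_def)
    ultimately have "\<exists>w\<in>W. \<exists>b\<in>B. e = {Inl w, Inr b}"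
      using uv by (auto simp: image_iff doubleton_eq_iff)
    with e show "e \<in> (\<lambda>(w, b). {Inl w, Inr b}) ` ?R" by blast
  qed auto
  with wb have "G = graph_of_rel W B ?R"
    by (simp add: graph_of_rel_def)
  then show "G \<in> graph_of_rel W B ` Pow (W \<times> B)" by blast
next
  fix G assume "G \<in> graph_of_rel W B ` Pow (W \<times> B)"
  then obtain R where R: "R \<subseteq> W \<times> B" "G = graph_of_rel W B R" by blast
  then have "e \<subseteq> Inl ` W \<union> Inr ` B \<and> card e = 2" if "e \<in> edges G" for e
    using that by (auto simp: graph_of_rel_def)
  moreover have "u \<in> Inl ` W \<longleftrightarrow> v \<in> Inr ` B" if "{u, v} \<in> edges G" for u v
    using that R by (auto simp: graph_of_rel_def doubleton_eq_iff)
  moreover have "whites G = Inl ` W" "blacks G = Inr ` B"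
    using R by (simp_all add: graph_of_rel_def)
  ultimately show "G \<in> structs bicolored_graphs W B"
    using assms by (auto simp: bicolored_graphs_def bicolored_graph_def)
qed

lemma relabel_graph_of_rel:
  assumes "f ` W = W" "g ` B = B"
  shows "relabel (map_sum f g) (graph_of_rel W B R) = graph_of_rel W B (map_prod f g ` R)"
proof -
  have "map_sum f g ` Inl ` W = Inl ` W" "map_sum f g ` Inr ` B = Inr ` B"
    by (simp_all add: image_image assms flip: image_image [of Inl f] image_image [of Inr g])
  then show ?thesis
    by (simp add: relabel_def graph_of_rel_def image_image case_prod_unfold)
qed

lemma card_fixed_bicolored_graphs:
  assumes "finite W" "f permutes W" "finite B" "g permutes B"
  shows "card {G \<in> structs bicolored_graphs W B. transport bicolored_graphs W B f g G = G}
    = 2 ^ (\<Sum>i\<in>#cycle_type W f. \<Sum>j\<in>#cycle_type B g. gcd i j)"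
proof -
  let ?h = "map_prod f g"
  have "{G \<in> structs bicolored_graphs W B. transport bicolored_graphs W B f g G = G}
      = {G \<in> graph_of_rel W B ` Pow (W \<times> B). relabel (map_sum f g) G = G}"
    using assms by (simp add: structs_eq_graph_of_rel) (simp add: bicolored_graphs_def)
  also have "\<dots> = graph_of_rel W B ` {R. R \<subseteq> W \<times> B \<and> ?h ` R = R}"
    using assms relabel_graph_of_rel [of f W g B] inj_graph_of_rel [of W B]
    by (auto simp: permutes_image inj_eq)
  also have "card \<dots> = card {R. R \<subseteq> W \<times> B \<and> ?h ` R = R}"
    by (rule card_image [OF inj_on_subset [OF inj_graph_of_rel]]) simp
  also have "\<dots> = 2 ^ card (orbit ?h ` (W \<times> B))"
  proof (rule card_invariant_subsets)
    fix z assume z: "z \<in> W \<times> B"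
    have "fst z \<in> orbit f (fst z)" "snd z \<in> orbit g (snd z)"
      using assms by (simp_all add: permutes_self_in_orbit)
    then show "z \<in> orbit ?h z"
      using self_in_orbit_map_prod [of "fst z" f "snd z" g] by simp
    have "y \<in> W \<times> B" if "y \<in> orbit ?h z" for y
      using that by induction (use z assms in \<open>auto simp: permutes_in_image\<close>)
    then show "orbit ?h z \<subseteq> W \<times> B" by blast
  qed (use assms in simp)
  finally show ?thesis
    using card_orbits_Times [OF assms] by simp
qed

section \<open>Permutations of given cycle type\<close>

lemma exists_cyclic_permutation:
  assumes "finite A" "A \<noteq> {}"
  shows "\<exists>f. f permutes A \<and> cyclic_on f A"
proof -
  let ?n = "card A"
  have n: "?n > 0"
    using assms by (simp add: card_gt_0_iff)
  obtain e where e: "bij_betw e {..<?n} A"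
    using ex_bij_betw_nat_finite [OF assms(1)] by (auto simp: lessThan_atLeast0)
  define i where "i = inv_into {..<?n} e"
  \<comment> \<open>\<open>f\<close> moves each element to its successor in the cyclic enumeration \<open>e\<close>.\<close>
  define f where "f x = (if x \<in> A then e (Suc (i x) mod ?n) else x)" for x
  have ie: "i (e k) = k" if "k < ?n" for k
    using e that by (simp add: i_def bij_betw_inv_into_left)
  have eA: "e k \<in> A" if "k < ?n" for k
    using e that by (auto simp: bij_betw_def)
  have fe: "f (e k) = e (Suc k mod ?n)" if "k < ?n" for k
    using that by (simp add: f_def ie eA)
  have pow: "(f ^^ k) (e 0) = e (k mod ?n)" for k
    by (induction k) (simp_all add: fe n mod_Suc_eq)
  have "orbit f (e 0) = {(f ^^ m) (e 0) | m. m < ?n}"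
    using pow [of ?n] n by (intro orbit_altdef_bounded) simp_all
  also have "\<dots> = e ` {..<?n}"
    by (auto simp: pow) (metis mod_less)
  also have "\<dots> = A"
    using e by (simp add: bij_betw_def)
  finally have orbit: "orbit f (e 0) = A" .
  with eA [OF n] have self: "e 0 \<in> orbit f (e 0)"
    by simp
  then have cyc: "cyclic_on f A"
    using orbit by (auto simp: cyclic_on_def)
  have "f ` A = A"
    using orbit_inverse [OF self, of f f] self_in_orbit_step [OF self] orbit by simp
  then have "bij_betw f A A"
    using assms(1) by (simp add: bij_betw_def eq_card_imp_inj_on)
  then have "f permutes A"
    by (rule bij_imp_permutes) (simp add: f_def)
  with cyc show ?thesis by blast
qed

text \<open>
  The composite of permutations of disjoint blocks acts on each block as the respective factor, so
  its cycles are those of the two factors.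
\<close>

lemma cycle_type_comp_disjoint:
  assumes "finite A" "f permutes A" "cyclic_on f A" "finite S" "g permutes S" "A \<inter> S = {}"
  shows "cycle_type (A \<union> S) (f \<circ> g) = add_mset (card A) (cycle_type S g)"
proof -
  have "cyclic_on (f \<circ> g) A"
    using assms by (intro permutes_comp_preserves_cyclic1 [of g S f A A]) auto
  then have A: "orbit (f \<circ> g) ` A = {A}"
    by (auto simp: cyclic_on_alldef)
  have S: "orbit (f \<circ> g) x = orbit g x" if "x \<in> S" for x
  proof (rule orbit_cong)
    show "x \<in> orbit g x"
      using assms by (simp add: permutes_self_in_orbit)
    fix y assume "y \<in> orbit g x"
    then have "g y \<in> S"
      using permutes_orbit_subset [OF assms(5) that] assms(5) by (auto simp: permutes_in_image)
    then show "(f \<circ> g) y = g y"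
      using assms by (auto intro: permutes_not_in)
  qed
  have "A \<notin> orbit g ` S"
    using permutes_orbit_subset [OF assms(5)] assms(3,6) orbit_nonempty by fastforce
  moreover have "orbit (f \<circ> g) ` (A \<union> S) = insert A (orbit g ` S)"
    using A S by (simp add: image_Un)
  ultimately show ?thesis
    using assms(4) by (simp add: cycle_type_def)
qed

lemma exists_permutation_of_cycle_type:
  assumes "finite S" "card S = sum_mset lam" "0 \<notin># lam"
  shows "\<exists>f. f permutes S \<and> cycle_type S f = lam"
  using assms
proof (induction lam arbitrary: S)
  case empty
  then show ?case by (auto simp: cycle_type_def intro: permutes_id)
next
  case (add k lam)
  then obtain A where A: "A \<subseteq> S" "card A = k" "finite A"
    using obtain_subset_with_card_n [of k S] by auto
  with add.prems have "A \<noteq> {}" by auto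
  then obtain f where f: "f permutes A" "cyclic_on f A"
    using A exists_cyclic_permutation by blast
  have "card (S - A) = sum_mset lam"
    using A add.prems by (simp add: card_Diff_subset)
  then obtain g where g: "g permutes S - A" "cycle_type (S - A) g = lam"
    using add by (metis finite_Diff union_iff add_mset_add_single)
  have S: "A \<union> (S - A) = S"
    using A by blast
  have "cycle_type S (f \<circ> g) = add_mset k lam"
    using cycle_type_comp_disjoint [OF A(3) f _ g(1)] A g add.prems(1) S by simp
  moreover have "f \<circ> g permutes S"
    using f(1) g(1) A(1) by (meson Diff_subset permutes_compose permutes_subset)
  ultimately show ?case by blast
qed

lemma perm_of_type:
  assumes "lam \<in> partitions_of n"
  shows "perm_of_type lam permutes {1..sum_mset lam}"
    and "cycle_type {1..sum_mset lam} (perm_of_type lam) = lam"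
proof -
  have "\<exists>f. f permutes {1..sum_mset lam} \<and> cycle_type {1..sum_mset lam} f = lam"
    using assms by (intro exists_permutation_of_cycle_type) (auto simp: partitions_of_def)
  from someI_ex [OF this] show "perm_of_type lam permutes {1..sum_mset lam}"
    and "cycle_type {1..sum_mset lam} (perm_of_type lam) = lam"
    unfolding perm_of_type_def by blast+
qed

section \<open>The cycle index of bicolored graphs\<close>

lemma fix_count_bicolored_graphs:
  assumes "lam \<in> partitions_of m" "mu \<in> partitions_of n"
  shows "fix_count bicolored_graphs lam mu = 2 ^ (\<Sum>i\<in>#lam. \<Sum>j\<in>#mu. gcd i j)"
  using card_fixed_bicolored_graphs [OF _ perm_of_type(1) [OF assms(1)] _ perm_of_type(1) [OF assms(2)]]
  by (simp only: fix_count_def perm_of_type(2) [OF assms(1)] perm_of_type(2) [OF assms(2)]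
      finite_atLeastAtMost True_implies_equals)

theorem theorem5p1:
  shows "cycle_index bicolored_graphs =
    (\<Sum>\<^sub>\<infinity>(m, n). \<Sum>lam\<in>partitions_of m. \<Sum>mu\<in>partitions_of n.
       mps_smult (2 ^ (\<Sum>i\<in>#lam. \<Sum>j\<in>#mu. gcd i j))
         (mps_smult (1 / of_nat (zee lam)) (p_x lam) * mps_smult (1 / of_nat (zee mu)) (p_y mu)))"
  unfolding cycle_index_def
  by (intro infsum_cong) (auto intro!: sum.cong simp: fix_count_bicolored_graphs)

end
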